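(* The standard form of a linear chain is unique in its birational class up to reversion: if $A$ and $B$ are birationally equivalent standard linear chains, then $B=A$ or $B=A^*$, where $A^*$ is the reversion of $A$ (with $A^*=A$ if $A=[[0_{2k+1}]]$).
   Context: Graphs are finite, nonempty, connected, loops and multiple edges allowed, each vertex having an integer weight. A linear chain $[[w_0,\dots,w_n]]$ is a path graph with consecutive vertices of weights $w_0,\dots,w_n$ (chains are considered up to reading them from either end). Inside brackets $0_m$ denotes $m$ consecutive entries $0$. A linear chain is standard if, for a suitable orientation, it is one of $[[0_{2k},w_1,\dots,w_n]]$ or $[[0_{2k+1}]]$ with $k,n\ge 0$ and all $w_i\le -2$. The reversion of $L=[[0_{2k},w_1,\dots,w_n]]$ is $L^*=[[0_{2k},w_n,\dots,w_1]]$. An inner blowup at an edge $e$ with end points $v_0,v_1$ subdivides $e$ by a new vertex of weight $-1$ and decreases the weights of $v_0$ and $v_1$ by $1$. An outer blowup at a vertex $v_0$ adds a new vertex of weight $-1$ joined to $v_0$ by one new edge and decreases the weight of $v_0$ by $1$. The inverse operations are blowdowns. Two weighted graphs are birationally equivalent if one can be transformed into the other by a finite sequence of blowups and blowdowns (the intermediate graphs need not be linear). *)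

theory Defs
  imports "HOL-Library.Multiset" "HOL-Library.Uprod"
begin

text \<open>
  Undirected weighted multigraphs. Edges form a multiset of unordered pairs, so parallel edges
  and loops (\<open>Upair v v\<close>) are allowed. Values of \<open>weight\<close> outside \<open>verts\<close> carry no meaning.
\<close>
record 'v wgraph =
  verts :: "'v set"
  edges :: "'v uprod multiset"
  weight :: "'v \<Rightarrow> int"

definition connected_graph :: "'v wgraph \<Rightarrow> bool" where
  "connected_graph G \<longleftrightarrow>
     (\<forall>u\<in>verts G. \<forall>v\<in>verts G. (\<lambda>x y. Upair x y \<in># edges G)\<^sup>*\<^sup>* u v)"

definition weighted_graph :: "'v wgraph \<Rightarrow> bool" where
  "weighted_graph G \<longleftrightarrow>
     finite (verts G) \<and> verts G \<noteq> {} \<and>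
     (\<forall>e \<in># edges G. set_uprod e \<subseteq> verts G) \<and>
     connected_graph G"

definition graph_iso :: "'v wgraph \<Rightarrow> 'w wgraph \<Rightarrow> bool" where
  "graph_iso G H \<longleftrightarrow>
     (\<exists>f. bij_betw f (verts G) (verts H) \<and>
          edges H = image_mset (map_uprod f) (edges G) \<and>
          (\<forall>v\<in>verts G. weight H (f v) = weight G v))"

text \<open>
  \<open>v\<close> is the new vertex. At a loop the two ends of the edge coincide, and the weight decreases
  by 1 for each end, that is, by 2.
\<close>
definition inner_blowup :: "'v wgraph \<Rightarrow> 'v wgraph \<Rightarrow> bool" where
  "inner_blowup G G' \<longleftrightarrow> weighted_graph G \<and>
     (\<exists>v0 v1 v. Upair v0 v1 \<in># edges G \<and> v \<notin> verts G \<and>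
        G' = \<lparr> verts = insert v (verts G),
               edges = edges G - {#Upair v0 v1#} + {#Upair v0 v, Upair v v1#},
               weight = (\<lambda>x. weight G x - of_bool (x = v0) - of_bool (x = v1))(v := - 1) \<rparr>)"

definition outer_blowup :: "'v wgraph \<Rightarrow> 'v wgraph \<Rightarrow> bool" where
  "outer_blowup G G' \<longleftrightarrow> weighted_graph G \<and>
     (\<exists>v0 v. v0 \<in> verts G \<and> v \<notin> verts G \<and>
        G' = \<lparr> verts = insert v (verts G),
               edges = edges G + {#Upair v0 v#},
               weight = (weight G)(v0 := weight G v0 - 1, v := - 1) \<rparr>)"

definition blowup :: "'v wgraph \<Rightarrow> 'v wgraph \<Rightarrow> bool" where
  "blowup G G' \<longleftrightarrow> inner_blowup G G' \<or> outer_blowup G G'"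

text \<open>
  Graphs are identified up to isomorphism, so isomorphisms may be interspersed with blowups and
  blowdowns. Vertices are natural numbers because the vertex type has to be infinite for every
  graph to admit blowups (a fresh vertex is needed); every finite graph has an isomorphic copy
  of this kind.
\<close>
definition birationally_equivalent :: "nat wgraph \<Rightarrow> nat wgraph \<Rightarrow> bool" where
  "birationally_equivalent =
     (\<lambda>G H. blowup G H \<or> blowup H G \<or> (weighted_graph G \<and> weighted_graph H \<and> graph_iso G H))\<^sup>*\<^sup>*"

text \<open>
  \<open>G\<close> is the linear chain $[[w_0,\dots,w_n]]$ for \<open>ws = [w\<^sub>0, \<dots>, w\<^sub>n]\<close>. Since \<open>vs\<close> may list the
  path from either end, \<open>linear_chain G ws\<close> and \<open>linear_chain G (rev ws)\<close> are equivalent.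
\<close>
definition linear_chain :: "'v wgraph \<Rightarrow> int list \<Rightarrow> bool" where
  "linear_chain G ws \<longleftrightarrow>
     (\<exists>vs. vs \<noteq> [] \<and> distinct vs \<and> verts G = set vs \<and>
           edges G = mset (map2 Upair (butlast vs) (tl vs)) \<and>
           map (weight G) vs = ws)"

text \<open>The empty word (\<open>k = 0\<close>, \<open>ws = []\<close>) is excluded since a linear chain is nonempty.\<close>
definition standard_chain :: "'v wgraph \<Rightarrow> bool" where
  "standard_chain G \<longleftrightarrow>
     (\<exists>k ws. (\<forall>w\<in>set ws. w \<le> - 2) \<and> linear_chain G (replicate (2 * k) 0 @ ws)) \<or>
     (\<exists>k. linear_chain G (replicate (2 * k + 1) 0))"

text \<open>
  \<open>H\<close> is (a copy of) the reversion of the standard linear chain \<open>G\<close>. Only the part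
  $w_1,\dots,w_n$ is reversed; the zeros stay in front.
\<close>
definition reversion_of :: "'v wgraph \<Rightarrow> 'w wgraph \<Rightarrow> bool" where
  "reversion_of G H \<longleftrightarrow>
     (\<exists>k ws. (\<forall>w\<in>set ws. w \<le> - 2) \<and>
             linear_chain G (replicate (2 * k) 0 @ ws) \<and>
             linear_chain H (replicate (2 * k) 0 @ rev ws)) \<or>
     (\<exists>k. linear_chain G (replicate (2 * k + 1) 0) \<and>
          linear_chain H (replicate (2 * k + 1) 0))"

end

theory Submission imports Defs begin

text \<open>
  Two invariants of blowups suffice. The intersection form changes by an orthogonal summand
  \<open>\<langle>-1\<rangle>\<close>, so its positive index is invariant; for a standard chain it is the number \<open>k\<close> of
  pairs of zeros. Modulo \<open>N\<close>, the labellings of the vertices orthogonal to all rows of the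
  intersection matrix (homomorphisms from its cokernel to \<open>\<int>/N\<close>) extend uniquely to a blowup, and
  the formal sum \<open>\<Sum>\<^sub>v (deg v - 2) [x v]\<close>, the logarithm of the Reidemeister torsion of the
  plumbed 3-manifold, does not change. For a chain this sum is \<open>-[x first] - [x last]\<close>, and the
  labellings are the multiples of one with \<open>x last = 1\<close>, \<open>x first = q\<close>, where \<open>d/q\<close> is the continued
  fraction of the chain. Hence \<open>d\<close> is determined, and \<open>q\<close> modulo \<open>d\<close> up to inversion. Inverting \<open>q\<close>
  reverses the chain, and \<open>d/q\<close> determines its entries.
\<close>

section \<open>The intersection form of a weighted graph\<close>

text \<open>The share of one edge in row \<open>v\<close> of the adjacency matrix applied to
  \<open>x\<close>. A loop at \<open>v\<close> gives \<open>2 * x v\<close>, in accordance with the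
  weight drop of 2 when it is blown up.\<close>

lift_definition nbr_value :: "('v \<Rightarrow> int) \<Rightarrow> 'v \<Rightarrow> 'v uprod \<Rightarrow> int" is
  "\<lambda>x v (a, b). of_bool (v = a) * x b + of_bool (v = b) * x a"
  by auto

lemma nbr_value_Upair [simp]:
  "nbr_value x v (Upair a b) = of_bool (v = a) * x b + of_bool (v = b) * x a"
  by transfer simp

lemma nbr_value_outside: "v \<notin> set_uprod e \<Longrightarrow> nbr_value x v e = 0"
  by (cases e) auto

definition nbr_sum :: "'v uprod multiset \<Rightarrow> ('v \<Rightarrow> int) \<Rightarrow> 'v \<Rightarrow> int" where
  "nbr_sum E x v = (\<Sum>e\<in>#E. nbr_value x v e)"

lemma nbr_sum_simps [simp]:
  "nbr_sum {#} x v = 0"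
  "nbr_sum (add_mset e E) x v = nbr_value x v e + nbr_sum E x v"
  "nbr_sum (E + F) x v = nbr_sum E x v + nbr_sum F x v"
  by (simp_all add: nbr_sum_def)

lemma nbr_sum_outside:
  assumes "\<And>e. e \<in># E \<Longrightarrow> v \<notin> set_uprod e"
  shows "nbr_sum E x v = 0"
  using assms unfolding nbr_sum_def by (intro sum_mset.neutral) (auto simp: nbr_value_outside)

text \<open>Row \<open>v\<close> of the intersection matrix applied to \<open>x\<close>: the
  intersection number of the cycle with multiplicities \<open>x\<close> with the curve of
  \<open>v\<close>.\<close>

definition intersection :: "'v wgraph \<Rightarrow> ('v \<Rightarrow> int) \<Rightarrow> 'v \<Rightarrow> int" where
  "intersection G x v = weight G v * x v + nbr_sum (edges G) x v"

definition self_intersection :: "'v wgraph \<Rightarrow> ('v \<Rightarrow> int) \<Rightarrow> int" where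
  "self_intersection G x = (\<Sum>v\<in>verts G. x v * intersection G x v)"

definition labelling :: "int \<Rightarrow> 'v wgraph \<Rightarrow> ('v \<Rightarrow> int) \<Rightarrow> bool" where
  "labelling N G x \<longleftrightarrow> (\<forall>v\<in>verts G. N dvd intersection G x v)"

text \<open>The sum below is the value at the residue class of \<open>a\<close> of the formal sum of the classes
  \<open>x v\<close> with multiplicity \<open>deg v - 2\<close>; \<open>nbr_sum (edges G) (\<lambda>_. 1) v\<close> is the degree of \<open>v\<close>.\<close>

definition torsion :: "int \<Rightarrow> 'v wgraph \<Rightarrow> ('v \<Rightarrow> int) \<Rightarrow> int \<Rightarrow> int" where
  "torsion N G x a =
     (\<Sum>v\<in>verts G. (nbr_sum (edges G) (\<lambda>_. 1) v - 2) * of_bool (N dvd x v - a))"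

text \<open>No labelling is distinguished, so the invariant collects the torsions of all of
  them.\<close>

definition torsions :: "int \<Rightarrow> 'v wgraph \<Rightarrow> (int \<Rightarrow> int) set" where
  "torsions N G = torsion N G ` {x. labelling N G x}"

text \<open>The positive index without diagonalisation: positivity for every nonzero
  \<open>c\<close> makes the \<open>L i\<close> a basis of a positive definite sublattice of rank
  \<open>k\<close>.\<close>

definition positive_rank_ge :: "nat \<Rightarrow> 'v wgraph \<Rightarrow> bool" where
  "positive_rank_ge k G \<longleftrightarrow>
     (\<exists>L. \<forall>c. (\<exists>i<k. c i \<noteq> 0) \<longrightarrow> self_intersection G (\<lambda>v. \<Sum>i<k. c i * L i v) > 0)"

section \<open>Invariance\<close>

lemma nbr_sum_cong:
  assumes "\<And>e. e \<in># E \<Longrightarrow> set_uprod e \<subseteq> V" "\<And>u. u \<in> V \<Longrightarrow> x u = y u"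
  shows "nbr_sum E x v = nbr_sum E y v"
  unfolding nbr_sum_def
proof (rule arg_cong[where f = sum_mset], rule image_mset_cong)
  fix e assume "e \<in># E"
  with assms show "nbr_value x v e = nbr_value y v e" by (cases e) fastforce
qed

lemma intersection_cong:
  assumes "\<forall>e\<in>#edges G. set_uprod e \<subseteq> verts G" "\<And>u. u \<in> verts G \<Longrightarrow> x u = y u" "v \<in> verts G"
  shows "intersection G x v = intersection G y v"
  using nbr_sum_cong[of "edges G" "verts G" x y v] assms by (simp add: intersection_def)

lemma self_intersection_cong:
  assumes "\<forall>e\<in>#edges G. set_uprod e \<subseteq> verts G" "\<And>u. u \<in> verts G \<Longrightarrow> x u = y u"
  shows "self_intersection G x = self_intersection G y"
  unfolding self_intersection_def
  using assms intersection_cong[OF assms] by (intro sum.cong) auto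

lemma labelling_cong:
  assumes "\<forall>e\<in>#edges G. set_uprod e \<subseteq> verts G" "\<And>u. u \<in> verts G \<Longrightarrow> x u = y u"
  shows "labelling N G x \<longleftrightarrow> labelling N G y"
  unfolding labelling_def using intersection_cong[OF assms] by auto

lemma torsion_cong:
  assumes "\<And>u. u \<in> verts G \<Longrightarrow> x u = y u"
  shows "torsion N G x = torsion N G y"
  unfolding torsion_def using assms by (intro ext sum.cong) auto

text \<open>Both kinds of blowup add a vertex \<open>v\<close> of weight \<open>-1\<close> and replace every old curve \<open>E u\<close> by
  \<open>E u - c u * E v\<close>, where \<open>c u\<close> counts how often \<open>E u\<close> passes through the centre.\<close>

definition pullback_mult :: "'v wgraph \<Rightarrow> ('v \<Rightarrow> int) \<Rightarrow> ('v \<Rightarrow> int) \<Rightarrow> int" where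
  "pullback_mult G c x = (\<Sum>u\<in>verts G. c u * x u)"

lemma blowup_effect:
  assumes "blowup G G'"
  obtains v c where
    "finite (verts G)" "\<forall>e\<in>#edges G. set_uprod e \<subseteq> verts G"
    "v \<notin> verts G" "verts G' = insert v (verts G)"
    "\<And>x. intersection G' x v = pullback_mult G c x - x v"
    "\<And>x u. u \<in> verts G \<Longrightarrow>
       intersection G' x u = intersection G x u + c u * (x v - pullback_mult G c x)"
    "\<And>N x. N dvd x v - pullback_mult G c x \<Longrightarrow> torsion N G' x = torsion N G x"
  using assms unfolding blowup_def
proof (elim disjE)
  assume "inner_blowup G G'"
  then obtain v0 v1 v where fin: "finite (verts G)"
    and sub: "\<forall>e\<in>#edges G. set_uprod e \<subseteq> verts G"
    and e: "Upair v0 v1 \<in># edges G" and v: "v \<notin> verts G"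
    and G': "G' = \<lparr> verts = insert v (verts G),
               edges = edges G - {#Upair v0 v1#} + {#Upair v0 v, Upair v v1#},
               weight = (\<lambda>x. weight G x - of_bool (x = v0) - of_bool (x = v1))(v := - 1) \<rparr>"
    unfolding inner_blowup_def weighted_graph_def by blast
  obtain E where E: "edges G = add_mset (Upair v0 v1) E" using e by (metis insert_DiffM)
  have v01: "v0 \<in> verts G" "v1 \<in> verts G" using e sub by fastforce+
  then have vne: "v0 \<noteq> v" "v1 \<noteq> v" using v by auto
  \<comment> \<open>At a loop both terms count, so the multiplicity is 2.\<close>
  define c :: "_ \<Rightarrow> int" where "c u = of_bool (u = v0) + of_bool (u = v1)" for u
  have pm: "pullback_mult G c x = x v0 + x v1" for x
  proof -
    have "c u * x u = (if u = v0 then x u else 0) + (if u = v1 then x u else 0)" for u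
      by (simp add: c_def)
    then show ?thesis
      using fin v01 by (simp add: pullback_mult_def sum.distrib)
  qed
  have E0: "nbr_sum E x v = 0" for x
    using sub v by (intro nbr_sum_outside) (auto simp: E)
  have nv: "nbr_sum (edges G') x v = x v0 + x v1" for x
    using vne E0 by (simp add: G' E)
  \<comment> \<open>In the row of each old end, the opposite end is exchanged for
    \<open>v\<close>.\<close>
  have nu: "nbr_sum (edges G') x u = nbr_sum (edges G) x u
      + of_bool (u = v0) * (x v - x v1) + of_bool (u = v1) * (x v - x v0)"
    if "u \<in> verts G" for x u
    using that v by (auto simp: G' E algebra_simps)
  show ?thesis
  proof (rule that[of v c])
    show "intersection G' x v = pullback_mult G c x - x v" for x
      by (simp add: intersection_def nv pm) (simp add: G')
    show "intersection G' x u = intersection G x u + c u * (x v - pullback_mult G c x)"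
      if "u \<in> verts G" for x u
    proof -
      have "weight G' u = weight G u - c u" using that v by (auto simp: G' c_def)
      then show ?thesis
        by (simp add: intersection_def nu[OF that] pm) (auto simp: c_def algebra_simps)
    qed
    \<comment> \<open>The new vertex has valency 2, hence coefficient 0, and the old valencies are
      kept.\<close>
    show "torsion N G' x = torsion N G x" for N x
    proof
      fix a
      have "torsion N G' x a = (\<Sum>u\<in>insert v (verts G). 
          (nbr_sum (edges G') (\<lambda>_. 1) u - 2) * of_bool (N dvd x u - a))"
        by (simp add: torsion_def) (simp add: G')
      also have "\<dots> = (\<Sum>u\<in>verts G. (nbr_sum (edges G') (\<lambda>_. 1) u - 2) * of_bool (N dvd x u - a))"
        using fin v by (subst sum.insert) (simp_all add: nv)
      also have "\<dots> = torsion N G x a"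
        unfolding torsion_def by (intro sum.cong) (auto simp: nu)
      finally show "torsion N G' x a = torsion N G x a" .
    qed
  qed (use fin sub v in \<open>auto simp: G'\<close>)
next
  assume "outer_blowup G G'"
  then obtain v0 v where fin: "finite (verts G)"
    and sub: "\<forall>e\<in>#edges G. set_uprod e \<subseteq> verts G"
    and v0: "v0 \<in> verts G" and v: "v \<notin> verts G"
    and G': "G' = \<lparr> verts = insert v (verts G), edges = edges G + {#Upair v0 v#},
               weight = (weight G)(v0 := weight G v0 - 1, v := - 1) \<rparr>"
    unfolding outer_blowup_def weighted_graph_def by blast
  have vne: "v0 \<noteq> v" using v v0 by auto
  define c :: "_ \<Rightarrow> int" where "c u = of_bool (u = v0)" for u
  have pm: "pullback_mult G c x = x v0" for x
  proof -
    have "c u * x u = (if u = v0 then x u else 0)" for u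
      by (simp add: c_def)
    then show ?thesis
      using fin v0 by (simp add: pullback_mult_def)
  qed
  have E0: "nbr_sum (edges G) x v = 0" for x
    using sub v by (intro nbr_sum_outside) auto
  have nv: "nbr_sum (edges G') x v = x v0" for x
    using vne E0 by (simp add: G')
  have nu: "nbr_sum (edges G') x u = nbr_sum (edges G) x u + c u * x v"
    if "u \<in> verts G" for x u
    using that v by (auto simp: G' c_def)
  show ?thesis
  proof (rule that[of v c])
    show "intersection G' x v = pullback_mult G c x - x v" for x
      by (simp add: intersection_def nv pm) (simp add: G')
    show "intersection G' x u = intersection G x u + c u * (x v - pullback_mult G c x)"
      if "u \<in> verts G" for x u
    proof -
      have "weight G' u = weight G u - c u" using that v by (auto simp: G' c_def)
      then show ?thesis
        by (simp add: intersection_def nu[OF that] pm) (auto simp: c_def algebra_simps)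
    qed
    show "torsion N G' x = torsion N G x" if dvd: "N dvd x v - pullback_mult G c x" for N x
    proof
      fix a
      \<comment> \<open>The new leaf contributes \<open>-1\<close> in the class of
        \<open>x v\<close>, the increased valency of \<open>v0\<close> contributes \<open>+1\<close>
        in the class of \<open>x v0\<close>; these classes agree.\<close>
      have same: "N dvd x v - a \<longleftrightarrow> N dvd x v0 - a"
        using dvd_add_right_iff[of N "x v - x v0" "x v0 - a"] dvd by (simp add: pm)
      have "torsion N G' x a = (\<Sum>u\<in>insert v (verts G). 
          (nbr_sum (edges G') (\<lambda>_. 1) u - 2) * of_bool (N dvd x u - a))"
        by (simp add: torsion_def) (simp add: G')
      also have "\<dots> = (\<Sum>u\<in>verts G. (nbr_sum (edges G') (\<lambda>_. 1) u - 2) * of_bool (N dvd x u - a))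
          - of_bool (N dvd x v - a)"
        using fin v by (subst sum.insert) (simp_all add: nv)
      also have "(\<Sum>u\<in>verts G. (nbr_sum (edges G') (\<lambda>_. 1) u - 2) * of_bool (N dvd x u - a))
          = (\<Sum>u\<in>verts G. (nbr_sum (edges G) (\<lambda>_. 1) u - 2) * of_bool (N dvd x u - a)
              + c u * of_bool (N dvd x u - a))"
        by (intro sum.cong) (auto simp: nu algebra_simps)
      also have "\<dots> = torsion N G x a + of_bool (N dvd x v0 - a)"
        using pm[of "\<lambda>u. of_bool (N dvd x u - a)"]
        by (simp add: sum.distrib torsion_def pullback_mult_def)
      finally show "torsion N G' x a = torsion N G x a" by (simp add: same)
    qed
  qed (use fin sub v in \<open>auto simp: G'\<close>)
qed

lemma pullback_mult_cong:
  "(\<And>u. u \<in> verts G \<Longrightarrow> x u = y u) \<Longrightarrow> pullback_mult G c x = pullback_mult G c y"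
  by (simp add: pullback_mult_def)

text \<open>Row \<open>v\<close> of \<open>G'\<close> makes \<open>x v\<close> congruent to the
  pullback multiplicity, and then the correction terms in the other rows vanish modulo
  \<open>N\<close>. So a labelling of \<open>G\<close> extends in exactly one way modulo
  \<open>N\<close>.\<close>

lemma torsions_blowup:
  assumes "blowup G G'"
  shows "torsions N G' = torsions N G"
proof -
  from assms obtain v c where fin: "finite (verts G)"
    and sub: "\<forall>e\<in>#edges G. set_uprod e \<subseteq> verts G"
    and v: "v \<notin> verts G" and V: "verts G' = insert v (verts G)"
    and iv: "\<And>x. intersection G' x v = pullback_mult G c x - x v"
    and iu: "\<And>x u. u \<in> verts G \<Longrightarrow>
       intersection G' x u = intersection G x u + c u * (x v - pullback_mult G c x)"
    and tor: "\<And>N x. N dvd x v - pullback_mult G c x \<Longrightarrow> torsion N G' x = torsion N G x"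
    by (rule blowup_effect) blast
  have lab: "labelling N G' x \<longleftrightarrow> labelling N G x \<and> N dvd x v - pullback_mult G c x" for x
  proof -
    have "N dvd pullback_mult G c x - x v \<longleftrightarrow> N dvd x v - pullback_mult G c x"
      by (rule dvd_diff_commute)
    then show ?thesis
      unfolding labelling_def V by (auto simp: iv iu dvd_add_left_iff)
  qed
  show ?thesis
  proof (intro equalityI subsetI)
    fix t assume "t \<in> torsions N G'"
    then show "t \<in> torsions N G" by (auto simp: torsions_def lab tor)
  next
    fix t assume "t \<in> torsions N G"
    then obtain x where x: "labelling N G x" "t = torsion N G x" by (auto simp: torsions_def)
    define y where "y = x(v := pullback_mult G c x)"
    have xy: "x u = y u" if "u \<in> verts G" for u using that v by (auto simp: y_def)
    have yv: "y v = pullback_mult G c y"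
      using pullback_mult_cong[of G x y c, OF xy] by (simp add: y_def)
    have "labelling N G' y"
      using x(1) labelling_cong[of G x y N, OF sub xy] by (simp add: lab yv)
    moreover have "torsion N G' y = t"
      using torsion_cong[of G x y N, OF xy] x(2) by (simp add: tor yv)
    ultimately show "t \<in> torsions N G'" by (auto simp: torsions_def)
  qed
qed

text \<open>The form of \<open>G'\<close> is that of \<open>G\<close> minus one square. Positive
  families restrict to \<open>G\<close>, and those of \<open>G\<close> extend so that the square
  vanishes.\<close>

lemma positive_rank_blowup:
  assumes "blowup G G'"
  shows "positive_rank_ge k G' \<longleftrightarrow> positive_rank_ge k G"
proof -
  from assms obtain v c where fin: "finite (verts G)"
    and sub: "\<forall>e\<in>#edges G. set_uprod e \<subseteq> verts G"
    and v: "v \<notin> verts G" and V: "verts G' = insert v (verts G)"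
    and iv: "\<And>x. intersection G' x v = pullback_mult G c x - x v"
    and iu: "\<And>x u. u \<in> verts G \<Longrightarrow>
       intersection G' x u = intersection G x u + c u * (x v - pullback_mult G c x)"
    by (rule blowup_effect) blast
  have Q: "self_intersection G' x = self_intersection G x - (x v - pullback_mult G c x)\<^sup>2" for x
  proof -
    let ?p = "pullback_mult G c x"
    have "self_intersection G' x = x v * (?p - x v)
        + (\<Sum>u\<in>verts G. x u * (intersection G x u + c u * (x v - ?p)))"
      using fin v by (simp add: self_intersection_def V iv iu)
    also have "(\<Sum>u\<in>verts G. x u * (intersection G x u + c u * (x v - ?p)))
        = self_intersection G x + (x v - ?p) * ?p"
      unfolding self_intersection_def
      by (subst (3) pullback_mult_def)
        (simp add: distrib_left sum.distrib sum_distrib_left mult_ac)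
    finally show ?thesis by (simp add: power2_eq_square algebra_simps)
  qed
  show ?thesis
  proof
    assume "positive_rank_ge k G'"
    then obtain L where L: "\<And>a. \<exists>i<k. a i \<noteq> 0 \<Longrightarrow> 0 < self_intersection G' (\<lambda>v. \<Sum>i<k. a i * L i v)"
      unfolding positive_rank_ge_def by blast
    show "positive_rank_ge k G"
      unfolding positive_rank_ge_def
    proof (intro exI[of _ L] allI impI)
      fix a assume "\<exists>i<k. a i \<noteq> (0::int)"
      from L[OF this] show "0 < self_intersection G (\<lambda>v. \<Sum>i<k. a i * L i v)"
        unfolding Q by (smt (verit) zero_le_power2)
    qed
  next
    assume "positive_rank_ge k G"
    then obtain L where L: "\<And>a. \<exists>i<k. a i \<noteq> 0 \<Longrightarrow> 0 < self_intersection G (\<lambda>v. \<Sum>i<k. a i * L i v)"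
      unfolding positive_rank_ge_def by blast
    \<comment> \<open>The total transform. It is linear in \<open>L i\<close>, so the square
      vanishes on all combinations.\<close>
    define L' where "L' i = (L i)(v := pullback_mult G c (L i))" for i
    show "positive_rank_ge k G'"
      unfolding positive_rank_ge_def
    proof (intro exI[of _ L'] allI impI)
      fix a assume a: "\<exists>i<k. a i \<noteq> (0::int)"
      define x where "x = (\<lambda>v. \<Sum>i<k. a i * L i v)"
      define y where "y = (\<lambda>v. \<Sum>i<k. a i * L' i v)"
      have xy: "x u = y u" if "u \<in> verts G" for u 
        using that v by (auto simp: x_def y_def L'_def intro!: sum.cong)
      have "pullback_mult G c x = (\<Sum>i<k. a i * pullback_mult G c (L i))"
        unfolding pullback_mult_def x_def sum_distrib_left
        by (subst sum.swap) (simp add: mult_ac)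
      also have "\<dots> = y v" by (simp add: y_def L'_def)
      finally have "y v = pullback_mult G c y" using pullback_mult_cong[of G x y c, OF xy] by simp
      then have "self_intersection G' y = self_intersection G x"
        using self_intersection_cong[of G x y, OF sub xy] by (simp add: Q)
      then show "0 < self_intersection G' y" using L[OF a] by (simp add: x_def)
    qed
  qed
qed

section \<open>Invariance under isomorphism and birational equivalence\<close>

lemma nbr_sum_iso:
  assumes "inj_on f V" "\<And>e. e \<in># E \<Longrightarrow> set_uprod e \<subseteq> V" "v \<in> V"
  shows "nbr_sum (image_mset (map_uprod f) E) x (f v) = nbr_sum E (x \<circ> f) v"
  unfolding nbr_sum_def image_mset.compositionality
proof (rule arg_cong[where f = sum_mset], rule image_mset_cong)
  fix e assume "e \<in># E"
  with assms(2) have "set_uprod e \<subseteq> V" by blast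
  with assms(1,3) show "(nbr_value x (f v) \<circ> map_uprod f) e = nbr_value (x \<circ> f) v e"
    by (cases e) (auto simp: inj_on_eq_iff)
qed

lemma iso_effect:
  assumes "weighted_graph G" "graph_iso G H"
  obtains f where "bij_betw f (verts G) (verts H)"
    "\<And>N x. labelling N H x \<longleftrightarrow> labelling N G (x \<circ> f)"
    "\<And>N x. torsion N H x = torsion N G (x \<circ> f)"
    "\<And>x. self_intersection H x = self_intersection G (x \<circ> f)"
proof -
  from assms(2) obtain f where f: "bij_betw f (verts G) (verts H)"
    and E: "edges H = image_mset (map_uprod f) (edges G)"
    and w: "\<forall>v\<in>verts G. weight H (f v) = weight G v" unfolding graph_iso_def by blast
  have inj: "inj_on f (verts G)" and V: "verts H = f ` verts G"
    using f by (auto simp: bij_betw_def)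
  have ns: "nbr_sum (edges H) x (f v) = nbr_sum (edges G) (x \<circ> f) v" if "v \<in> verts G" for x v
    unfolding E using assms(1) that by (intro nbr_sum_iso[OF inj]) (auto simp: weighted_graph_def)
  have int: "intersection H x (f v) = intersection G (x \<circ> f) v" if "v \<in> verts G" for x v
    using w that by (simp add: intersection_def ns)
  show thesis
  proof (rule that[OF f])
    show "labelling N H x \<longleftrightarrow> labelling N G (x \<circ> f)" for N x
      by (simp add: labelling_def V int)
    show "torsion N H x = torsion N G (x \<circ> f)" for N x
      by (rule ext) (simp add: torsion_def V sum.reindex[OF inj] ns o_def cong: sum.cong)
    show "self_intersection H x = self_intersection G (x \<circ> f)" for x
      by (simp add: self_intersection_def V sum.reindex[OF inj] int cong: sum.cong)
  qed
qed

lemma torsions_iso: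
  assumes "weighted_graph G" "graph_iso G H"
  shows "torsions N H = torsions N G"
proof -
  from assms obtain f where f: "bij_betw f (verts G) (verts H)"
    and lab: "\<And>N x. labelling N H x \<longleftrightarrow> labelling N G (x \<circ> f)"
    and tor: "\<And>N x. torsion N H x = torsion N G (x \<circ> f)"
    by (rule iso_effect) blast
  have sub: "\<forall>e\<in>#edges G. set_uprod e \<subseteq> verts G" using assms by (simp add: weighted_graph_def)
  show ?thesis
  proof (intro equalityI subsetI)
    fix t assume "t \<in> torsions N H"
    then show "t \<in> torsions N G" by (auto simp: torsions_def lab tor)
  next
    fix t assume "t \<in> torsions N G"
    then obtain x where x: "labelling N G x" "t = torsion N G x" by (auto simp: torsions_def)
    define y where "y = x \<circ> inv_into (verts G) f"
    have xy: "x u = (y \<circ> f) u" if "u \<in> verts G" for u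
      using that f by (simp add: y_def bij_betw_def)
    have "labelling N H y" "torsion N H y = t"
      using labelling_cong[of G x "y \<circ> f" N, OF sub xy] torsion_cong[of G x "y \<circ> f" N, OF xy] x by (simp_all add: lab tor)
    then show "t \<in> torsions N H" by (auto simp: torsions_def)
  qed
qed

lemma positive_rank_iso:
  assumes "weighted_graph G" "graph_iso G H"
  shows "positive_rank_ge k H \<longleftrightarrow> positive_rank_ge k G"
proof -
  from assms obtain f where f: "bij_betw f (verts G) (verts H)"
    and Q: "\<And>x. self_intersection H x = self_intersection G (x \<circ> f)"
    by (rule iso_effect) blast
  have sub: "\<forall>e\<in>#edges G. set_uprod e \<subseteq> verts G" using assms by (simp add: weighted_graph_def)
  show ?thesis
  proof
    assume "positive_rank_ge k H"
    then obtain L where L: "\<And>a. \<exists>i<k. a i \<noteq> 0 \<Longrightarrow> 0 < self_intersection H (\<lambda>v. \<Sum>i<k. a i * L i v)"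
      unfolding positive_rank_ge_def by blast
    show "positive_rank_ge k G"
      unfolding positive_rank_ge_def
      by (rule exI[of _ "\<lambda>i. L i \<circ> f"]) (use L in \<open>simp add: Q o_def\<close>)
  next
    assume "positive_rank_ge k G"
    then obtain L where L: "\<And>a. \<exists>i<k. a i \<noteq> 0 \<Longrightarrow> 0 < self_intersection G (\<lambda>v. \<Sum>i<k. a i * L i v)"
      unfolding positive_rank_ge_def by blast
    define g where "g = inv_into (verts G) f"
    have gf: "g (f u) = u" if "u \<in> verts G" for u using that f by (simp add: g_def bij_betw_def)
    show "positive_rank_ge k H"
      unfolding positive_rank_ge_def
    proof (intro exI[of _ "\<lambda>i. L i \<circ> g"] allI impI)
      fix a assume "\<exists>i<k. a i \<noteq> (0::int)"
      then have "0 < self_intersection G (\<lambda>v. \<Sum>i<k. a i * L i v)" by (rule L)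
      also have "\<dots> = self_intersection H (\<lambda>v. \<Sum>i<k. a i * (L i \<circ> g) v)"
        unfolding Q by (rule self_intersection_cong[OF sub]) (simp add: gf)
      finally show "0 < self_intersection H (\<lambda>v. \<Sum>i<k. a i * (L i \<circ> g) v)" .
    qed
  qed
qed

lemma birational_invariants:
  assumes "birationally_equivalent G H"
  shows "torsions N G = torsions N H" "positive_rank_ge k G \<longleftrightarrow> positive_rank_ge k H"
proof -
  have "torsions N G = torsions N H \<and> (positive_rank_ge k G \<longleftrightarrow> positive_rank_ge k H)"
    using assms unfolding birationally_equivalent_def
  proof (induction rule: rtranclp_induct)
    case (step H K)
    then show ?case
      using torsions_blowup[of H K N] torsions_blowup[of K H N] torsions_iso[of H K N]
        positive_rank_blowup[of H K k] positive_rank_blowup[of K H k] positive_rank_iso[of H K k]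
      by argo
  qed simp
  then show "torsions N G = torsions N H" "positive_rank_ge k G \<longleftrightarrow> positive_rank_ge k H" by auto
qed

section \<open>Linear chains and continuants\<close>

text \<open>Row \<open>i\<close> of the tridiagonal intersection matrix of a chain. The case
  distinctions cut off the values of \<open>y\<close> beyond the two ends.\<close>

definition row :: "int list \<Rightarrow> (nat \<Rightarrow> int) \<Rightarrow> nat \<Rightarrow> int" where
  "row ws y i = (if i = 0 then 0 else y (i - 1)) + ws ! i * y i
     + (if Suc i < length ws then y (Suc i) else 0)"

definition chain_labelling :: "int \<Rightarrow> int list \<Rightarrow> (nat \<Rightarrow> int) \<Rightarrow> bool" where
  "chain_labelling N ws y \<longleftrightarrow> (\<forall>i<length ws. N dvd row ws y i)"

text \<open>By distinctness only the edges with index \<open>i - 1\<close> and \<open>i\<close> meet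
  \<open>vs ! i\<close>.\<close>

lemma nbr_sum_path:
  assumes "distinct vs" "i < length vs"
  shows "nbr_sum (mset (map2 Upair (butlast vs) (tl vs))) x (vs ! i) =
    (if i = 0 then 0 else x (vs ! (i - 1))) + (if Suc i < length vs then x (vs ! Suc i) else 0)"
proof -
  define m where "m = length vs - 1"
  have len: "length vs = Suc m" using assms by (simp add: m_def)
  have edges: "map2 Upair (butlast vs) (tl vs) = map (\<lambda>j. Upair (vs ! j) (vs ! Suc j)) [0..<m]"
    by (rule nth_equalityI) (auto simp: m_def nth_butlast nth_tl)
  have "nbr_sum (mset (map2 Upair (butlast vs) (tl vs))) x (vs ! i) =
      (\<Sum>j<m. nbr_value x (vs ! i) (Upair (vs ! j) (vs ! Suc j)))"
    unfolding nbr_sum_def edges mset_map[symmetric] sum_mset_sum_list map_map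
    by (simp only: interv_sum_list_conv_sum_set_nat set_upt atLeast0LessThan o_def)
  also have "\<dots> = (\<Sum>j<m. (if j = i then x (vs ! Suc i) else 0) + (if i = Suc j then x (vs ! (i - 1)) else 0))"
    using assms len by (intro sum.cong) (auto simp: nth_eq_iff_index_eq)
  also have "\<dots> = (if i < m then x (vs ! Suc i) else 0) + (if i = 0 then 0 else x (vs ! (i - 1)))"
    using assms len by (cases i) (auto simp: sum.distrib)
  finally show ?thesis by (simp add: len)
qed

lemma linear_chainE:
  assumes "linear_chain G ws"
  obtains vs where "distinct vs" "verts G = set vs" "length vs = length ws" "ws \<noteq> []"
    "\<And>x i. i < length ws \<Longrightarrow> intersection G x (vs ! i) = row ws (\<lambda>j. x (vs ! j)) i"
    "\<And>i. i < length ws \<Longrightarrow>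
       nbr_sum (edges G) (\<lambda>_. 1) (vs ! i) = of_bool (i \<noteq> 0) + of_bool (Suc i < length ws)"
proof -
  from assms obtain vs where vs: "vs \<noteq> []" "distinct vs" "verts G = set vs"
      "edges G = mset (map2 Upair (butlast vs) (tl vs))" "map (weight G) vs = ws"
    unfolding linear_chain_def by blast
  note path = nbr_sum_path[OF vs(2), folded vs(4)]
  have len: "length vs = length ws" using vs(5) by auto
  show thesis
  proof (rule that[OF vs(2,3) len])
    show "ws \<noteq> []" using vs(1,5) by auto
    fix i assume i: "i < length ws"
    show "intersection G x (vs ! i) = row ws (\<lambda>j. x (vs ! j)) i" for x
    proof -
      have "weight G (vs ! i) = ws ! i" using i len nth_map[of i vs "weight G"] unfolding vs(5) by simp
      moreover have "nbr_sum (edges G) x (vs ! i) = (if i = 0 then 0 else x (vs ! (i - 1)))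
          + (if Suc i < length ws then x (vs ! Suc i) else 0)"
        using path[of i x] i len by simp
      ultimately show ?thesis by (simp add: intersection_def row_def)
    qed
    show "nbr_sum (edges G) (\<lambda>_. 1) (vs ! i) = of_bool (i \<noteq> 0) + of_bool (Suc i < length ws)"
      using path[of i "\<lambda>_. 1"] i len by simp
  qed
qed

lemma ex_on_nth:
  assumes "distinct vs"
  shows "\<exists>x. \<forall>i<length vs. x (vs ! i) = y i"
proof (rule exI[of _ "\<lambda>v. y (inv_into {..<length vs} ((!) vs) v)"], intro allI impI)
  fix i assume "i < length vs"
  then have "inv_into {..<length vs} ((!) vs) (vs ! i) = i"
    using assms by (intro inv_into_f_f) (auto simp: inj_on_def nth_eq_iff_index_eq)
  then show "y (inv_into {..<length vs} ((!) vs) (vs ! i)) = y i" by simp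
qed

lemma row_cong: "(\<And>i. i < length ws \<Longrightarrow> y i = z i) \<Longrightarrow> i < length ws \<Longrightarrow> row ws y i = row ws z i"
  by (auto simp: row_def)

text \<open>Inner vertices have valency 2 and drop out of the formal sum.\<close>

lemma torsions_chain:
  assumes "linear_chain G ws"
  shows "torsions N G =
    (\<lambda>y a. - of_bool (N dvd y 0 - a) - of_bool (N dvd y (length ws - 1) - a)) `
      {y. chain_labelling N ws y}" (is "_ = ?t ` _")
proof -
  from assms obtain vs where vs: "distinct vs" "verts G = set vs" "length vs = length ws" "ws \<noteq> []"
    and int: "\<And>x i. i < length ws \<Longrightarrow> intersection G x (vs ! i) = row ws (\<lambda>j. x (vs ! j)) i"
    and deg: "\<And>i. i < length ws \<Longrightarrow>
       nbr_sum (edges G) (\<lambda>_. 1) (vs ! i) = of_bool (i \<noteq> 0) + of_bool (Suc i < length ws)"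
    by (rule linear_chainE) blast
  define n where "n = length ws - 1"
  have len: "length ws = Suc n" using vs(4) by (simp add: n_def)
  have V: "verts G = (!) vs ` {..<length ws}"
    by (auto simp: vs(2) set_conv_nth vs(3)[symmetric])
  have inj: "inj_on ((!) vs) {..<length ws}"
    using vs(1,3) by (simp add: inj_on_def nth_eq_iff_index_eq)
  have lab: "labelling N G x \<longleftrightarrow> chain_labelling N ws (\<lambda>j. x (vs ! j))" for x
    by (auto simp: labelling_def chain_labelling_def V int)
  have tor: "torsion N G x = ?t (\<lambda>j. x (vs ! j))" for x
  proof
    fix a
    have "torsion N G x a = (\<Sum>i<length ws. (of_bool (i \<noteq> 0) + of_bool (Suc i < length ws) - 2)
        * of_bool (N dvd x (vs ! i) - a))"
      unfolding torsion_def V sum.reindex[OF inj] o_def by (intro sum.cong) (auto simp: deg)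
    \<comment> \<open>With separate terms for the two ends, a chain of one vertex
      (\<open>n = 0\<close>) correctly gets the coefficient \<open>-2\<close>.\<close>
    also have "\<dots> = (\<Sum>i<length ws. (if i = 0 then - of_bool (N dvd x (vs ! 0) - a) else 0)
        + (if i = n then - of_bool (N dvd x (vs ! n) - a) else 0))"
      by (intro sum.cong) (auto simp: len)
    also have "\<dots> = ?t (\<lambda>j. x (vs ! j)) a"
      using len by (simp add: sum.distrib del: sum.lessThan_Suc)
    finally show "torsion N G x a = ?t (\<lambda>j. x (vs ! j)) a" .
  qed
  show ?thesis
  proof (intro equalityI subsetI)
    fix t assume "t \<in> torsions N G"
    then show "t \<in> ?t ` {y. chain_labelling N ws y}" by (auto simp: torsions_def lab tor)
  next
    fix t assume "t \<in> ?t ` {y. chain_labelling N ws y}"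
    then obtain y where y: "chain_labelling N ws y" "t = ?t y" by auto
    obtain x where x: "\<And>i. i < length ws \<Longrightarrow> x (vs ! i) = y i"
      using ex_on_nth[OF vs(1), of y] vs(3) by auto
    have "labelling N G x"
      using y(1) row_cong[of ws "\<lambda>j. x (vs ! j)" y] x by (simp add: lab chain_labelling_def)
    moreover have "torsion N G x = t" using y(2) x len by (simp add: tor)
    ultimately show "t \<in> torsions N G" by (auto simp: torsions_def)
  qed
qed

text \<open>\<open>cont ws\<close> is the determinant of the negated intersection matrix of the chain \<open>ws\<close>, and
  \<open>cont ws / cont_tl ws\<close> is the continued fraction with entries \<open>-w\<close>. The junk value \<open>0\<close> at \<open>[]\<close>
  makes \<open>cont_Cons\<close> hold without a case distinction.\<close>

fun cont :: "int list \<Rightarrow> int" where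
  "cont [] = 1"
| "cont [w] = - w"
| "cont (w # v # ws) = - w * cont (v # ws) - cont ws"

definition cont_tl :: "int list \<Rightarrow> int" where
  "cont_tl ws = (if ws = [] then 0 else cont (tl ws))"

lemma cont_Cons: "cont (w # ws) = - w * cont ws - cont_tl ws"
  by (cases ws) (simp_all add: cont_tl_def)

lemma cont_tl_simps [simp]: "cont_tl [] = 0" "cont_tl (w # ws) = cont ws"
  by (simp_all add: cont_tl_def)

section \<open>Labellings of a chain in terms of continuants\<close>

lemma cont_drop:
  assumes "i < length ws"
  shows "cont (drop i ws) = - (ws ! i) * cont (drop (Suc i) ws)
     - (if Suc i < length ws then cont (drop (Suc (Suc i)) ws) else 0)"
  using assms by (auto simp: Cons_nth_drop_Suc[symmetric] cont_Cons)

text \<open>The rows are solved backwards from the value \<open>g\<close> at the last vertex.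
  \<open>cont_drop\<close> is the vanishing of the rows after the first; in row 0 the determinant is
  left over.\<close>

lemma row_cont:
  assumes "i < length ws"
  shows "row ws (\<lambda>j. cont (drop (Suc j) ws) * g) i = (if i = 0 then - cont ws * g else 0)"
proof -
  have "ws ! i * cont (drop (Suc i) ws) = - cont (drop i ws)
     - (if Suc i < length ws then cont (drop (Suc (Suc i)) ws) else 0)"
    using cont_drop[OF assms] by simp
  from arg_cong[OF this, of "\<lambda>t. t * g"] show ?thesis
    by (auto simp: row_def left_diff_distrib)
qed

lemma chain_labelling_cont:
  assumes "ws \<noteq> []"
  shows "chain_labelling N ws (\<lambda>j. cont (drop (Suc j) ws) * g) \<longleftrightarrow> N dvd cont ws * g"
  using assms by (auto simp: chain_labelling_def row_cont)

text \<open>Row \<open>Suc i\<close> expresses \<open>y i\<close> through the next two values, so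
  modulo \<open>N\<close> the last value determines all others.\<close>

lemma chain_labelling_unique:
  assumes "chain_labelling N ws y" "i < length ws"
  shows "N dvd y i - cont (drop (Suc i) ws) * y (length ws - 1)"
  using assms(2)
proof (induction "length ws - i" arbitrary: i rule: less_induct)
  case less
  define g where "g = y (length ws - 1)"
  let ?c = "\<lambda>j. cont (drop j ws)"
  show ?case
  proof (cases "Suc i < length ws")
    case False
    then have "i = length ws - 1" using less.prems by simp
    then show ?thesis using less.prems by simp
  next
    case True
    have 1: "N dvd y (Suc i) - ?c (Suc (Suc i)) * g"
      unfolding g_def using True by (intro less.hyps) auto
    \<comment> \<open>There is no second next value when \<open>Suc i\<close> is the last
      position.\<close>
    have 2: "N dvd (if Suc (Suc i) < length ws then y (Suc (Suc i)) - ?c (Suc (Suc (Suc i))) * g else 0)"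
      unfolding g_def using True less.hyps[of "Suc (Suc i)"] by auto
    have "N dvd row ws y (Suc i)" using assms(1) True by (simp add: chain_labelling_def)
    then have "N dvd row ws y (Suc i) - ws ! Suc i * (y (Suc i) - ?c (Suc (Suc i)) * g)
      - (if Suc (Suc i) < length ws then y (Suc (Suc i)) - ?c (Suc (Suc (Suc i))) * g else 0)"
      by (rule dvd_diff[OF dvd_diff[OF _ dvd_mult[OF 1]] 2])
    also have "\<dots> = y i - ?c (Suc i) * g"
      unfolding cont_drop[OF True] by (simp add: row_def algebra_simps)
    finally show ?thesis by (simp add: g_def)
  qed
qed

lemma chain_labelling_ends:
  assumes "chain_labelling N ws y" "ws \<noteq> []"
  shows "N dvd cont ws * y (length ws - 1)" "N dvd y 0 - cont_tl ws * y (length ws - 1)"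
proof -
  define g where "g = y (length ws - 1)"
  \<comment> \<open>The deviation from the backward solution is divisible by \<open>N\<close>, so
    row 0 can be evaluated on the backward solution instead of \<open>y\<close>.\<close>
  define z where "z i = y i - cont (drop (Suc i) ws) * g" for i
  have z: "N dvd z i" if "i < length ws" for i
    using chain_labelling_unique[OF assms(1) that] by (simp add: z_def g_def)
  show "N dvd y 0 - cont_tl ws * y (length ws - 1)"
    using z[of 0] assms(2) by (simp add: z_def g_def cont_tl_def drop_Suc)
  have "N dvd row ws z 0" using z assms(2) by (auto simp: row_def)
  moreover have "row ws z 0 = row ws y 0 - row ws (\<lambda>j. cont (drop (Suc j) ws) * g) 0"
    by (simp add: row_def z_def algebra_simps)
  moreover have "row ws (\<lambda>j. cont (drop (Suc j) ws) * g) 0 = - cont ws * g"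
    using assms(2) by (subst row_cont) auto
  moreover have "N dvd row ws y 0" using assms by (simp add: chain_labelling_def)
  ultimately have "N dvd row ws y 0 + cont ws * g" "N dvd row ws y 0" by simp_all
  then show "N dvd cont ws * y (length ws - 1)"
    using dvd_add_right_iff[of N "row ws y 0" "cont ws * g"] by (simp add: g_def)
qed

lemma chain_labelling_rev:
  assumes "chain_labelling N ws y"
  shows "chain_labelling N (rev ws) (\<lambda>i. y (length ws - 1 - i))"
  unfolding chain_labelling_def
proof (intro allI impI)
  fix i assume i: "i < length (rev ws)"
  define j where "j = length ws - 1 - i"
  have j: "j < length ws" "i = length ws - 1 - j" using i by (auto simp: j_def)
  have "row (rev ws) (\<lambda>i. y (length ws - 1 - i)) i = row ws y j"
  proof -
    have "length ws - 1 - Suc i = j - 1" "i \<noteq> 0 \<Longrightarrow> length ws - 1 - (i - 1) = Suc j"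
      "i = 0 \<longleftrightarrow> \<not> Suc j < length ws" "Suc i < length ws \<longleftrightarrow> j \<noteq> 0"
      "length ws - Suc i = j"
      using i by (auto simp: j_def)
    then show ?thesis using i by (auto simp: row_def rev_nth)
  qed
  then show "N dvd row (rev ws) (\<lambda>i. y (length ws - 1 - i)) i"
    using assms j by (simp add: chain_labelling_def)
qed

section \<open>Comparison of the torsions of two chains\<close>

text \<open>For \<open>N = cont ws\<close> the first chain has a labelling with end values
  \<open>cont_tl ws\<close> and 1. A labelling of the second chain with the same torsion has end
  values \<open>cont_tl ws' * h\<close> and \<open>h\<close> modulo \<open>N\<close>. The unordered
  pairs agree modulo \<open>N\<close>, which leaves two matchings.\<close>

lemma torsions_chain_dvd:
  assumes "ws \<noteq> []" "ws' \<noteq> []" "linear_chain G ws" "linear_chain H ws'"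
    and eq: "\<And>N. torsions N G = torsions N H"
  obtains h where "cont ws dvd cont ws' * h"
    "cont ws dvd h - 1 \<and> cont ws dvd cont_tl ws' * h - cont_tl ws \<or>
     cont ws dvd cont_tl ws' * h - 1 \<and> cont ws dvd h - cont_tl ws"
proof -
  define N where "N = cont ws"
  let ?t = "\<lambda>n y a. - of_bool (N dvd y 0 - a) - of_bool (N dvd y (n - 1) - a) :: int"
  define y where "y = (\<lambda>j. cont (drop (Suc j) ws) * 1)"
  have "chain_labelling N ws y"
    unfolding y_def using assms(1) by (subst chain_labelling_cont) (auto simp: N_def)
  then have "?t (length ws) y \<in> torsions N H"
    using torsions_chain[OF assms(3)] eq by blast
  then obtain z where z: "chain_labelling N ws' z" and t: "?t (length ws) y = ?t (length ws') z"
    unfolding torsions_chain[OF assms(4)] by blast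
  define h where "h = z (length ws' - 1)"
  have y: "y 0 = cont_tl ws" "y (length ws - 1) = 1"
    using assms(1) by (simp_all add: y_def cont_tl_def drop_Suc)
  note ends = chain_labelling_ends[OF z assms(2), folded h_def]
  have t': "of_bool (N dvd cont_tl ws - a) + of_bool (N dvd 1 - a)
      = (of_bool (N dvd z 0 - a) + of_bool (N dvd h - a) :: int)" for a
    using fun_cong[OF t, of a, unfolded y, folded h_def] by linarith
  have c: "N dvd z 0 - a \<longleftrightarrow> N dvd cont_tl ws' * h - a" for a
    using dvd_add_right_iff[OF ends(2), of "cont_tl ws' * h - a"] by simp
  have trans: "N dvd b - c" if "N dvd a - b" "N dvd a - c" for a b c :: int
    using dvd_diff[OF that(2,1)] by simp
  have "N dvd h - 1 \<and> N dvd cont_tl ws' * h - cont_tl ws \<or>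
     N dvd cont_tl ws' * h - 1 \<and> N dvd h - cont_tl ws"
    \<comment> \<open>The multiplicities at the classes of 1 and of \<open>cont_tl ws\<close>
      suffice to match the pairs.\<close>
    using t'[of 1] t'[of "cont_tl ws"] dvd_diff_commute[of N "cont_tl ws" 1]
      trans[of h "cont_tl ws" 1] trans[of "cont_tl ws' * h" "cont_tl ws" 1]
    by (auto simp: c of_bool_def split: if_splits)
  then show thesis using that ends(1) unfolding N_def by blast
qed

text \<open>\<open>h\<close> is a unit modulo \<open>N\<close> with inverse
  \<open>q\<close>.\<close>

lemma unit_dvd_cancel:
  fixes N :: int
  assumes "N dvd d * h" "N dvd q * h - 1"
  shows "N dvd d"
proof -
  have "d = q * (d * h) - d * (q * h - 1)" by (simp add: algebra_simps)
  then show ?thesis using assms by (metis dvd_diff dvd_mult)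
qed

text \<open>In both matchings \<open>h\<close> is a unit modulo \<open>cont ws\<close>: it is
  congruent to 1 or inverse to \<open>cont_tl ws'\<close>.\<close>

lemma cont_dvd_cont:
  assumes "ws \<noteq> []" "ws' \<noteq> []" "linear_chain G ws" "linear_chain H ws'"
    and "\<And>N. torsions N G = torsions N H"
  shows "cont ws dvd cont ws'"
  by (rule torsions_chain_dvd[OF assms]) (metis unit_dvd_cancel mult_1)

lemma torsions_chain_compare:
  assumes "linear_chain G ws" "linear_chain H ws'" "\<And>N. torsions N G = torsions N H"
  shows "\<bar>cont ws\<bar> = \<bar>cont ws'\<bar>"
    "cont ws dvd cont_tl ws' - cont_tl ws \<or> cont ws dvd cont_tl ws' * cont_tl ws - 1"
proof -
  have ne: "ws \<noteq> []" "ws' \<noteq> []" using assms(1,2) by (auto simp: linear_chain_def)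
  show "\<bar>cont ws\<bar> = \<bar>cont ws'\<bar>"
    using cont_dvd_cont[OF ne assms] cont_dvd_cont[OF ne(2,1) assms(2,1) assms(3)[symmetric]]
    by (rule zdvd_antisym_abs)
  from torsions_chain_dvd[OF ne assms] obtain h where h:
    "cont ws dvd h - 1 \<and> cont ws dvd cont_tl ws' * h - cont_tl ws \<or>
     cont ws dvd cont_tl ws' * h - 1 \<and> cont ws dvd h - cont_tl ws" by metis
  \<comment> \<open>Substituting for \<open>h\<close> its residue, 1 or \<open>cont_tl ws\<close>,
    eliminates it.\<close>
  then show "cont ws dvd cont_tl ws' - cont_tl ws \<or> cont ws dvd cont_tl ws' * cont_tl ws - 1"
  proof
    assume a: "cont ws dvd h - 1 \<and> cont ws dvd cont_tl ws' * h - cont_tl ws"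
    have "cont_tl ws' - cont_tl ws = (cont_tl ws' * h - cont_tl ws) - cont_tl ws' * (h - 1)"
      by (simp add: algebra_simps)
    then show ?thesis using a by (metis dvd_diff dvd_mult)
  next
    assume a: "cont ws dvd cont_tl ws' * h - 1 \<and> cont ws dvd h - cont_tl ws"
    have "cont_tl ws' * cont_tl ws - 1 = (cont_tl ws' * h - 1) - cont_tl ws' * (h - cont_tl ws)"
      by (simp add: algebra_simps)
    then show ?thesis using a by (metis dvd_diff dvd_mult)
  qed
qed

text \<open>Read backwards, the labelling with end values \<open>cont_tl ws\<close> and 1 starts
  with 1 and ends with \<open>cont_tl ws\<close>; \<open>chain_labelling_ends\<close> is applied to
  it on the reversed chain.\<close>

lemma cont_rev_dvd:
  assumes "ws \<noteq> []"
  shows "cont ws dvd cont (rev ws)" "cont ws dvd cont_tl (rev ws) * cont_tl ws - 1"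
proof -
  define y where "y = (\<lambda>j. cont (drop (Suc j) ws) * 1)"
  have "chain_labelling (cont ws) ws y"
    unfolding y_def using assms by (subst chain_labelling_cont) auto
  from chain_labelling_ends[OF chain_labelling_rev[OF this]]
  have "cont ws dvd cont (rev ws) * cont_tl ws" "cont ws dvd 1 - cont_tl (rev ws) * cont_tl ws"
    using assms by (simp_all add: y_def cont_tl_def drop_Suc)
  then show "cont ws dvd cont_tl (rev ws) * cont_tl ws - 1" by (simp add: dvd_diff_commute)
  with \<open>cont ws dvd cont (rev ws) * cont_tl ws\<close> show "cont ws dvd cont (rev ws)"
    by (rule unit_dvd_cancel)
qed

lemma abs_cont_rev: "\<bar>cont (rev ws)\<bar> = \<bar>cont ws\<bar>"
proof (cases "ws = []")
  case False
  then show ?thesis using cont_rev_dvd(1)[of ws] cont_rev_dvd(1)[of "rev ws"]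
    by (intro zdvd_antisym_abs) auto
qed simp

section \<open>Continued fractions of standard chains\<close>

text \<open>A pair of leading zeros negates numerator and denominator, so the continued fraction is
  unchanged.\<close>

lemma cont_zeros:
  "cont (replicate (2 * k) 0 @ ws) = (- 1) ^ k * cont ws"
  "cont_tl (replicate (2 * k) 0 @ ws) = (- 1) ^ k * cont_tl ws"
proof (induction k)
  case (Suc k)
  { case 1 then show ?case using Suc.IH by (simp add: cont_Cons)
  next case 2 then show ?case using Suc.IH by (simp add: cont_Cons) }
qed simp_all

text \<open>Numerators grow, since \<open>cont (w # ws)\<close> is at least
  \<open>2 * cont ws - cont_tl ws\<close>.\<close>

lemma cont_pos:
  assumes "\<forall>w\<in>set ws. w \<le> - 2"
  shows "0 \<le> cont_tl ws \<and> cont_tl ws < cont ws"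
  using assms
proof (induction ws)
  case (Cons w ws)
  then have "2 * cont ws \<le> - w * cont ws" by (intro mult_right_mono) auto
  then show ?case using Cons by (auto simp: cont_Cons)
qed simp

text \<open>Division with remainder: \<open>cont (w # ws)\<close> is \<open>- w * cont ws\<close>
  minus a remainder that is nonnegative and below \<open>cont ws\<close>, so it determines both
  \<open>w\<close> and the remainder \<open>cont_tl ws\<close>.\<close>

lemma cont_determines:
  assumes "\<forall>w\<in>set ws. w \<le> - 2" "\<forall>w\<in>set ws'. w \<le> - 2"
    "cont ws = cont ws'" "cont_tl ws = cont_tl ws'"
  shows "ws = ws'"
  using assms
proof (induction ws arbitrary: ws')
  case Nil
  then show ?case using cont_pos[of "tl ws'"] by (cases ws') auto
next
  case (Cons w ws)
  \<comment> \<open>With entries at most \<open>-2\<close>, only the empty chain has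
    \<open>cont_tl\<close> equal to 0.\<close>
  then obtain w' us where ws': "ws' = w' # us"
    using cont_pos[of ws] by (cases ws') auto
  have eq: "cont ws = cont us" using Cons.prems(4) by (simp add: ws')
  have ws_pos: "0 \<le> cont_tl ws" "cont_tl ws < cont ws" "0 \<le> cont_tl us" "cont_tl us < cont us"
    using cont_pos[of ws] cont_pos[of us] Cons.prems(1,2) by (auto simp: ws')
  have e: "(w' - w) * cont ws = cont_tl ws - cont_tl us"
    using Cons.prems(3) eq by (simp add: ws' cont_Cons algebra_simps)
  \<comment> \<open>Two remainders differ by less than the divisor.\<close>
  have "\<bar>(w' - w) * cont ws\<bar> < \<bar>cont ws\<bar>" unfolding e using ws_pos eq by linarith
  then have "\<bar>w' - w\<bar> * \<bar>cont ws\<bar> < 1 * \<bar>cont ws\<bar>" by (simp add: abs_mult)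
  then have "\<bar>w' - w\<bar> < 1" by (rule mult_right_less_imp_less) simp
  then have "w = w'" by simp
  with e have "cont_tl ws = cont_tl us" by simp
  then have "ws = us"
    using Cons.prems(1,2) eq by (intro Cons.IH) (auto simp: ws')
  then show ?case using ws' \<open>w = w'\<close> by simp
qed

lemma cont_rev:
  assumes "\<forall>w\<in>set ws. w \<le> - 2"
  shows "cont (rev ws) = cont ws"
  using abs_cont_rev[of ws] cont_pos[OF assms] cont_pos[of "rev ws"] assms by simp

lemma int_eq_of_dvd_diff:
  fixes a b d :: int
  assumes "d dvd a - b" "0 \<le> a" "a < d" "0 \<le> b" "b < d"
  shows "a = b"
  using dvd_imp_le_int[OF _ assms(1)] assms(2-) by fastforce

text \<open>By \<open>cont_pos\<close> each \<open>cont_tl\<close> is a least nonnegative residue,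
  so congruence means equality. In the second case \<open>cont_tl vs\<close> and
  \<open>cont_tl (rev us)\<close> are both inverse to \<open>cont_tl us\<close> modulo
  \<open>cont us\<close>.\<close>

lemma cont_determines_up_to_rev:
  assumes us: "\<forall>w\<in>set us. w \<le> - 2" and vs: "\<forall>w\<in>set vs. w \<le> - 2"
    and cont: "cont us = cont vs"
    and dvd: "cont us dvd cont_tl vs - cont_tl us \<or> cont us dvd cont_tl vs * cont_tl us - 1"
  shows "vs = us \<or> vs = rev us"
  using dvd
proof
  assume "cont us dvd cont_tl vs - cont_tl us"
  then have "cont_tl vs = cont_tl us"
    using cont_pos[OF us] cont_pos[OF vs] cont by (intro int_eq_of_dvd_diff) auto
  then show ?thesis using cont_determines[OF vs us] cont by simp
next
  assume vu: "cont us dvd cont_tl vs * cont_tl us - 1"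
  have rev: "\<forall>w\<in>set (rev us). w \<le> - 2" using us by simp
  show ?thesis
  proof (cases "us = []")
    \<comment> \<open>The determinant is 1, so the bounds force both \<open>cont_tl\<close> to be
      0.\<close>
    case True
    then show ?thesis using cont_determines[OF vs us] cont cont_pos[OF us] cont_pos[OF vs] by auto
  next
    case False
    from dvd_diff[OF vu cont_rev_dvd(2)[OF False]]
    have "cont us dvd (cont_tl vs - cont_tl (rev us)) * cont_tl us" by (simp add: algebra_simps)
    then have "cont us dvd cont_tl vs - cont_tl (rev us)" using vu by (rule unit_dvd_cancel)
    then have "cont_tl vs = cont_tl (rev us)"
      using cont_pos[OF rev] cont_pos[OF vs] cont cont_rev[OF us]
      by (intro int_eq_of_dvd_diff) auto
    then show ?thesis using cont_determines[OF vs rev] cont cont_rev[OF us] by simp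
  qed
qed

section \<open>The positive index of a standard chain\<close>

text \<open>The quadratic form of the tridiagonal matrix, recursive in the first vertex so that
  leading zeros can be split off.\<close>

fun chain_form :: "int list \<Rightarrow> (nat \<Rightarrow> int) \<Rightarrow> int" where
  "chain_form [] y = 0"
| "chain_form (w # ws) y = w * (y 0)\<^sup>2 + (if ws = [] then 0 else 2 * y 0 * y 1)
     + chain_form ws (\<lambda>i. y (Suc i))"

lemma sum_row_eq_chain_form: "(\<Sum>i<length ws. y i * row ws y i) = chain_form ws y"
proof (induction ws arbitrary: y)
  case (Cons w ws)
  let ?y = "\<lambda>i. y (Suc i)"
  \<comment> \<open>The extra term at \<open>i = 0\<close> is the link back to the removed first
    vertex.\<close>
  have row: "y (Suc i) * row (w # ws) y (Suc i) = ?y i * row ws ?y i + (if i = 0 then y 1 * y 0 else 0)"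
    for i
    by (cases i) (auto simp: row_def distrib_left)
  have "(\<Sum>i<length (w # ws). y i * row (w # ws) y i) =
      y 0 * row (w # ws) y 0 + (\<Sum>i<length ws. ?y i * row ws ?y i)
      + (\<Sum>i<length ws. if i = 0 then y 1 * y 0 else 0)"
    by (simp add: sum.lessThan_Suc_shift row sum.distrib del: sum.lessThan_Suc)
  also have "(\<Sum>i<length ws. if i = 0 then y 1 * y 0 else 0) = (if ws = [] then 0 else y 1 * y 0)"
    by simp
  also have "y 0 * row (w # ws) y 0 = w * (y 0)\<^sup>2 + (if ws = [] then 0 else y 0 * y 1)"
    by (simp add: row_def power2_eq_square algebra_simps)
  finally show ?case by (simp add: Cons.IH)
qed simp

lemma chain_form_cong:
  "(\<And>i. i < length ws \<Longrightarrow> y i = z i) \<Longrightarrow> chain_form ws y = chain_form ws z"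
proof (induction ws arbitrary: y z)
  case (Cons w ws)
  have "y 0 = z 0" "ws \<noteq> [] \<Longrightarrow> y 1 = z 1" using Cons.prems by auto
  moreover have "chain_form ws (\<lambda>i. y (Suc i)) = chain_form ws (\<lambda>i. z (Suc i))"
    using Cons.prems by (intro Cons.IH) auto
  ultimately show ?case by simp
qed simp

definition chain_positive :: "nat \<Rightarrow> int list \<Rightarrow> bool" where
  "chain_positive k ws \<longleftrightarrow>
     (\<exists>L. \<forall>c. (\<exists>i<k. c i \<noteq> 0) \<longrightarrow> chain_form ws (\<lambda>j. \<Sum>i<k. c i * L i j) > 0)"

lemma positive_rank_chain:
  assumes "linear_chain G ws"
  shows "positive_rank_ge k G \<longleftrightarrow> chain_positive k ws"
proof -
  from assms obtain vs where vs: "distinct vs" "verts G = set vs" "length vs = length ws"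
    and int: "\<And>x i. i < length ws \<Longrightarrow> intersection G x (vs ! i) = row ws (\<lambda>j. x (vs ! j)) i"
    by (rule linear_chainE) blast
  have V: "verts G = (!) vs ` {..<length ws}"
    by (auto simp: vs(2) set_conv_nth vs(3)[symmetric])
  have inj: "inj_on ((!) vs) {..<length ws}"
    using vs(1,3) by (simp add: inj_on_def nth_eq_iff_index_eq)
  have Q: "self_intersection G x = chain_form ws (\<lambda>j. x (vs ! j))" for x
    unfolding self_intersection_def V sum.reindex[OF inj] o_def sum_row_eq_chain_form[symmetric]
    by (intro sum.cong) (auto simp: int)
  show ?thesis
  proof
    assume "positive_rank_ge k G"
    then obtain L where "\<And>c. \<exists>i<k. c i \<noteq> 0 \<Longrightarrow> 0 < self_intersection G (\<lambda>v. \<Sum>i<k. c i * L i v)"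
      unfolding positive_rank_ge_def by blast
    then show "chain_positive k ws"
      unfolding chain_positive_def Q by (intro exI[of _ "\<lambda>i j. L i (vs ! j)"]) simp
  next
    assume "chain_positive k ws"
    then obtain L where L: "\<And>c. \<exists>i<k. c i \<noteq> 0 \<Longrightarrow> 0 < chain_form ws (\<lambda>j. \<Sum>i<k. c i * L i j)"
      unfolding chain_positive_def by blast
    have "\<forall>i. \<exists>x. \<forall>j<length vs. x (vs ! j) = L i j" using ex_on_nth[OF vs(1)] by blast
    then obtain M where M: "\<And>i j. j < length vs \<Longrightarrow> M i (vs ! j) = L i j" by metis
    have "0 < self_intersection G (\<lambda>v. \<Sum>i<k. c i * M i v)" if "\<exists>i<k. c i \<noteq> 0" for c
    proof -
      have "chain_form ws (\<lambda>j. \<Sum>i<k. c i * M i (vs ! j)) = chain_form ws (\<lambda>j. \<Sum>i<k. c i * L i j)"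
        by (rule chain_form_cong) (simp add: M vs(3))
      then show ?thesis using L[OF that] by (simp add: Q)
    qed
    then show "positive_rank_ge k G" unfolding positive_rank_ge_def by blast
  qed
qed

section \<open>Bounds for the index from below and above\<close>

lemma chain_form_zero: "chain_form ws (\<lambda>_. 0) = 0"
  by (induction ws) auto

text \<open>Each pair of zeros spans a hyperbolic plane, in which the vector \<open>(1, 1)\<close>
  has square 2.\<close>

lemma chain_positive_zeros: "chain_positive k (replicate (2 * k) 0 @ us)"
proof (induction k)
  case 0
  show ?case by (simp add: chain_positive_def)
next
  case (Suc k)
  define ws where "ws = replicate (2 * k) (0::int) @ us"
  have ws': "replicate (2 * Suc k) 0 @ us = 0 # 0 # ws" by (simp add: ws_def)
  from Suc obtain L
    where L: "\<And>c. \<exists>i<k. c i \<noteq> 0 \<Longrightarrow> 0 < chain_form ws (\<lambda>j. \<Sum>i<k. c i * L i j)"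
    unfolding chain_positive_def ws_def by blast
  \<comment> \<open>The entry \<open>- e i\<close> at the first zero makes an old vector orthogonal
    to \<open>(1, 1)\<close>, offsetting the edge from the second zero to the head of
    \<open>ws\<close> if there is one. The entry 0 at the second zero preserves the form on the old
    vectors.\<close>
  define e where "e i = (if ws = [] then 0 else L i 0)" for i
  define M :: "nat \<Rightarrow> nat \<Rightarrow> int" where
    "M i j = (case i of 0 \<Rightarrow> of_bool (j < 2)
       | Suc i \<Rightarrow> (case j of 0 \<Rightarrow> - e i | Suc 0 \<Rightarrow> 0 | Suc (Suc j) \<Rightarrow> L i j))" for i j
  show ?case
    unfolding chain_positive_def ws'
  proof (intro exI[of _ M] allI impI)
    fix c :: "nat \<Rightarrow> int" assume c: "\<exists>i<Suc k. c i \<noteq> 0"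
    define y where "y j = (\<Sum>i<Suc k. c i * M i j)" for j
    define z where "z j = (\<Sum>i<k. c (Suc i) * L i j)" for j
    define E where "E = (\<Sum>i<k. c (Suc i) * e i)"
    have y: "y 0 = c 0 - E" "y (Suc 0) = c 0" "y (Suc (Suc j)) = z j" for j
      unfolding y_def z_def E_def
      by (simp_all add: sum.lessThan_Suc_shift M_def sum_negf del: sum.lessThan_Suc)
    have E: "E = (if ws = [] then 0 else z 0)" by (simp add: E_def e_def z_def)
    have form: "chain_form (0 # 0 # ws) y = 2 * (c 0)\<^sup>2 + chain_form ws z"
      using E by (simp add: y power2_eq_square algebra_simps)
    have "0 < 2 * (c 0)\<^sup>2 + chain_form ws z"
    proof (cases "\<exists>i<k. c (Suc i) \<noteq> 0")
      case True
      then have "0 < chain_form ws z" unfolding z_def by (rule L)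
      then show ?thesis by (simp add: add_nonneg_pos)
    next
      case False
      then have "c 0 \<noteq> 0" using c less_Suc_eq_0_disj by auto
      moreover have "z = (\<lambda>_. 0)" using False by (auto simp: z_def)
      ultimately show ?thesis by (simp add: chain_form_zero)
    qed
    then show "0 < chain_form (0 # 0 # ws) (\<lambda>j. \<Sum>i<Suc k. c i * M i j)"
      using form unfolding y_def by simp
  qed
qed

text \<open>Every edge that meets a zero of the prefix has an end at an odd position of the prefix,
  where \<open>y\<close> vanishes; only the form of \<open>us\<close> remains.\<close>

lemma chain_form_zeros_nonpos:
  assumes "\<And>y. chain_form us y \<le> 0" "\<And>i. i < k \<Longrightarrow> y (2 * i + 1) = 0"
  shows "chain_form (replicate (2 * k) 0 @ us) y \<le> 0"
  using assms(2)
proof (induction k arbitrary: y)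
  case (Suc k)
  have "chain_form (replicate (2 * k) 0 @ us) (\<lambda>i. y (Suc (Suc i))) \<le> 0"
    using Suc.prems[of "Suc _"] by (intro Suc.IH) simp
  moreover have "y (Suc 0) = 0" using Suc.prems[of 0] by simp
  ultimately show ?case by simp
qed (use assms(1) in simp)

text \<open>The spare \<open>- (y 0)\<^sup>2\<close> absorbs the cross term with the preceding
  vertex in the induction.\<close>

lemma chain_form_negative:
  assumes "\<forall>w\<in>set ws. w \<le> - 2"
  shows "chain_form ws y \<le> (if ws = [] then 0 else - (y 0)\<^sup>2)"
  using assms
proof (induction ws arbitrary: y)
  case (Cons w ws)
  have w: "w * (y 0)\<^sup>2 \<le> - 2 * (y 0)\<^sup>2" using Cons.prems by (intro mult_right_mono) auto
  then have w': "w * (y 0)\<^sup>2 \<le> - (y 0)\<^sup>2" using zero_le_power2[of "y 0"] by linarith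
  have IH: "chain_form ws (\<lambda>i. y (Suc i)) \<le> (if ws = [] then 0 else - (y 1)\<^sup>2)"
    using Cons.IH[of "\<lambda>i. y (Suc i)"] Cons.prems by (cases "ws = []") simp_all
  have "0 \<le> (y 0 - y 1)\<^sup>2" by simp
  then have "2 * y 0 * y 1 \<le> (y 0)\<^sup>2 + (y 1)\<^sup>2" by (simp add: power2_diff)
  then show ?case using w w' IH by (simp split: if_splits)
qed simp

text \<open>Gaussian elimination without fractions, removing one equation and one unknown at a
  time.\<close>

lemma ex_nonzero_solution:
  fixes f :: "nat \<Rightarrow> 'a \<Rightarrow> int"
  assumes "finite J" "k < card J"
  shows "\<exists>c. (\<exists>j\<in>J. c j \<noteq> 0) \<and> (\<forall>i<k. (\<Sum>j\<in>J. c j * f i j) = 0)"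
  using assms
proof (induction k arbitrary: J f)
  case 0
  then have "J \<noteq> {}" by auto
  then show ?case by (intro exI[of _ "\<lambda>_. 1"]) auto
next
  case (Suc k)
  show ?case
  proof (cases "\<forall>j\<in>J. f k j = 0")
    case True
    from Suc.IH[of J f] Suc.prems obtain c where
      "\<exists>j\<in>J. c j \<noteq> 0" "\<forall>i<k. (\<Sum>j\<in>J. c j * f i j) = 0" by auto
    then show ?thesis using True by (intro exI[of _ c]) (auto simp: less_Suc_eq)
  next
    case False
    then obtain p where p: "p \<in> J" "f k p \<noteq> 0" by blast
    define K where "K = J - {p}"
    have K: "finite K" "k < card K" "p \<notin> K" "J = insert p K" using Suc.prems p by (auto simp: K_def)
    from Suc.IH[OF K(1,2), of "\<lambda>i j. f k p * f i j - f i p * f k j"] obtain c where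
      c: "\<exists>j\<in>K. c j \<noteq> 0" "\<And>i. i < k \<Longrightarrow> (\<Sum>j\<in>K. c j * (f k p * f i j - f i p * f k j)) = 0"
      by blast
    \<comment> \<open>The value at the pivot \<open>p\<close> makes equation \<open>k\<close> hold;
      scaling the other values by \<open>f k p\<close> avoids division.\<close>
    define b where "b j = (if j = p then - (\<Sum>j\<in>K. c j * f k j) else f k p * c j)" for j
    have b: "(\<Sum>j\<in>J. b j * f i j) = (\<Sum>j\<in>K. c j * (f k p * f i j - f i p * f k j))" for i
    proof -
      have "(\<Sum>j\<in>J. b j * f i j) = b p * f i p + (\<Sum>j\<in>K. b j * f i j)"
        using K by simp
      also have "(\<Sum>j\<in>K. b j * f i j) = (\<Sum>j\<in>K. f k p * c j * f i j)"
        using K(3) by (intro sum.cong) (auto simp: b_def)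
      also have "b p * f i p = - (\<Sum>j\<in>K. c j * f k j * f i p)"
        by (simp add: b_def sum_distrib_right)
      finally show ?thesis by (simp add: right_diff_distrib sum_subtractf mult_ac)
    qed
    have "(\<Sum>j\<in>J. b j * f i j) = 0" if "i < Suc k" for i
      unfolding b using c(2) that by (cases "i = k") auto
    moreover have "\<exists>j\<in>J. b j \<noteq> 0" using c(1) p K(3,4) by (auto simp: b_def)
    ultimately show ?thesis by blast
  qed
qed

text \<open>Vanishing at the odd positions of the prefix amounts to \<open>k\<close> linear
  conditions. Among more than \<open>k\<close> vectors a nontrivial combination satisfies them all,
  and there the form is not positive.\<close>

lemma chain_positive_zeros_le:
  assumes nonpos: "\<And>y. chain_form us y \<le> 0"
    and pos: "chain_positive m (replicate (2 * k) 0 @ us)"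
  shows "m \<le> k"
proof (rule ccontr)
  assume "\<not> m \<le> k"
  from pos obtain L where
    L: "\<And>c. \<exists>i<m. c i \<noteq> 0 \<Longrightarrow> 0 < chain_form (replicate (2 * k) 0 @ us) (\<lambda>j. \<Sum>i<m. c i * L i j)"
    unfolding chain_positive_def by blast
  from ex_nonzero_solution[of "{..<m}" k "\<lambda>i j. L j (2 * i + 1)"] \<open>\<not> m \<le> k\<close>
  obtain c where c: "\<exists>i<m. c i \<noteq> 0" "\<And>i. i < k \<Longrightarrow> (\<Sum>j<m. c j * L j (2 * i + 1)) = 0" by auto
  have "chain_form (replicate (2 * k) 0 @ us) (\<lambda>j. \<Sum>i<m. c i * L i j) \<le> 0"
    using nonpos c(2) by (rule chain_form_zeros_nonpos)
  then show False using L[OF c(1)] by simp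
qed

section \<open>Uniqueness of the standard form\<close>

lemma linear_chain_iso:
  assumes "linear_chain G ws" "linear_chain H ws"
  shows "graph_iso G H"
proof -
  from assms obtain vs us where vs: "distinct vs" "verts G = set vs"
      "edges G = mset (map2 Upair (butlast vs) (tl vs))" "map (weight G) vs = ws"
    and us: "distinct us" "verts H = set us"
      "edges H = mset (map2 Upair (butlast us) (tl us))" "map (weight H) us = ws"
    unfolding linear_chain_def by blast
  have len: "length us = length vs" using vs(4) us(4) by (metis length_map)
  from ex_on_nth[OF vs(1), of "(!) us"] obtain f where f: "\<And>i. i < length vs \<Longrightarrow> f (vs ! i) = us ! i"
    by blast
  have map: "map f vs = us" using len f by (simp add: list_eq_iff_nth_eq)
  have "bij_betw f (set vs) (set us)"
    using map us(1) by (metis bij_betw_def distinct_map set_map)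
  moreover have "edges H = image_mset (map_uprod f) (edges G)"
    by (simp add: vs(3) us(3) map[symmetric] map_butlast[symmetric] map_tl[symmetric] zip_map_map
        multiset.map_comp o_def case_prod_unfold flip: mset_map)
  moreover have "weight H (f v) = weight G v" if v: "v \<in> set vs" for v
  proof -
    have "map (weight H \<circ> f) vs = map (weight G) vs" using vs(4) us(4) map by (simp flip: map_map)
    then show ?thesis using v by (simp add: map_eq_conv)
  qed
  ultimately show ?thesis unfolding graph_iso_def vs(2) us(2) by blast
qed

text \<open>An odd string of zeros is read as pairs followed by \<open>[0]\<close>, so that both
  kinds of standard chain are treated together.\<close>

lemma standard_chainE:
  assumes "standard_chain G"
  obtains k us where "linear_chain G (replicate (2 * k) 0 @ us)"
    "(\<forall>w\<in>set us. w \<le> - 2) \<or> us = [0]"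
  using assms unfolding standard_chain_def
  by (metis replicate_add replicate_0 One_nat_def replicate_Suc)

lemma standard_form_nonpos:
  assumes "(\<forall>w\<in>set us. w \<le> - 2) \<or> us = [0]"
  shows "chain_form us y \<le> 0"
  using assms
proof
  assume "\<forall>w\<in>set us. w \<le> - 2"
  then have "chain_form us y \<le> (if us = [] then 0 else - (y 0)\<^sup>2)"
    by (rule chain_form_negative)
  also have "\<dots> \<le> 0" by simp
  finally show ?thesis .
qed simp

theorem corollary3p32:
  fixes A B :: "nat wgraph"
  assumes "standard_chain A" and "standard_chain B"
    and "birationally_equivalent A B"
  shows "graph_iso A B \<or> reversion_of A B"
proof -
  from standard_chainE[OF assms(1)] obtain k us where
    A: "linear_chain A (replicate (2 * k) 0 @ us)" and us: "(\<forall>w\<in>set us. w \<le> - 2) \<or> us = [0]" .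
  from standard_chainE[OF assms(2)] obtain m vs where
    B: "linear_chain B (replicate (2 * m) 0 @ vs)" and vs: "(\<forall>w\<in>set vs. w \<le> - 2) \<or> vs = [0]" .
  note inv = birational_invariants[OF assms(3)]
  \<comment> \<open>The positive index is the number of pairs of zeros.\<close>
  have "chain_positive k (replicate (2 * m) 0 @ vs)" "chain_positive m (replicate (2 * k) 0 @ us)"
    using inv(2) chain_positive_zeros positive_rank_chain[OF A] positive_rank_chain[OF B] by blast+
  then have "k \<le> m" "m \<le> k"
    using chain_positive_zeros_le[of vs k m] chain_positive_zeros_le[of us m k]
      standard_form_nonpos[OF us] standard_form_nonpos[OF vs] by blast+
  then have k: "m = k" by simp
  \<comment> \<open>The sign caused by the zeros is common to \<open>cont\<close> and
    \<open>cont_tl\<close>; it squares to 1 in the product and does not affect divisibility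
    elsewhere.\<close>
  define s :: int where "s = (- 1) ^ k"
  have s: "s = 1 \<or> s = - 1" unfolding s_def by (cases "even k") auto
  from torsions_chain_compare[OF A B inv(1)]
  have abs: "\<bar>cont us\<bar> = \<bar>cont vs\<bar>"
    and dvd: "cont us dvd cont_tl vs - cont_tl us \<or> cont us dvd cont_tl vs * cont_tl us - 1"
    using s unfolding k cont_zeros s_def[symmetric]
    by (auto simp: minus_dvd_iff dvd_diff_commute)
  have "vs = us \<or> (\<forall>w\<in>set us. w \<le> - 2) \<and> vs = rev us"
  proof (cases "(\<forall>w\<in>set us. w \<le> - 2) \<and> (\<forall>w\<in>set vs. w \<le> - 2)")
    case True
    then have "cont us = cont vs" using abs cont_pos[of us] cont_pos[of vs] by auto
    with True dvd show ?thesis using cont_determines_up_to_rev by blast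
  next
    \<comment> \<open>One tail is \<open>[0]\<close>, with \<open>cont\<close> equal to 0. A tail
      with entries at most \<open>-2\<close> has positive \<open>cont\<close>, so the other tail is
      \<open>[0]\<close> too.\<close>
    case False
    then show ?thesis using us vs abs cont_pos[of us] cont_pos[of vs] by auto
  qed
  then show ?thesis
  proof
    assume "vs = us"
    then show ?thesis using linear_chain_iso A B k by blast
  next
    assume "(\<forall>w\<in>set us. w \<le> - 2) \<and> vs = rev us"
    then show ?thesis using A B unfolding reversion_of_def k by blast
  qed
qed

end
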